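(* Let $\mathbb{F}$ be a field of characteristic zero. There is at most one circular integral functional on $\mathbb{F}[\alpha_1,\alpha_2]$ with respect to $S^1$; that is, if $\phi$ and $\phi'$ are both circular integral functionals with respect to $S^1$, then $\phi=\phi'$.
   Context: $S^1=\{[x,y]\in\mathbb{F}^2: x^2+y^2=1_{\mathbb{F}}\}$. $SO(2,\mathbb{F})$ is the group of $2\times2$ matrices $h$ over $\mathbb{F}$ with $h^{-1}=h^T$ and $\det h=1$, acting on $\mathbb{F}[\alpha_1,\alpha_2]$ by $h\cdot\pi(\alpha_1,\alpha_2)=\pi(h_{11}\alpha_1+h_{21}\alpha_2,\,h_{12}\alpha_1+h_{22}\alpha_2)$. A circular integral functional with respect to $S^1$ is an $\mathbb{F}$-linear map $\phi:\mathbb{F}[\alpha_1,\alpha_2]\to\mathbb{F}$ such that (Normalization) $\phi(\mathbf{1})=1_{\mathbb{F}}$ for the constant polynomial $\mathbf{1}$; (Locality) $\phi(\pi)=0$ whenever $\pi(x,y)=0$ for all $[x,y]\in S^1$; (Invariance) $\phi(h\cdot\pi)=\phi(\pi)$ for all $\pi$ and all $h\in SO(2,\mathbb{F})$. *)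

theory Defs
  imports "HOL-Analysis.Determinants" "HOL-Computational_Algebra.Polynomial"
begin

text \<open>
  The ring \<open>F[\<alpha>\<^sub>1, \<alpha>\<^sub>2]\<close> is represented as \<open>F[\<alpha>\<^sub>1][\<alpha>\<^sub>2]\<close>, the type \<^typ>\<open>'a poly poly\<close>: the outer
  variable is \<open>\<alpha>\<^sub>2\<close>, and the coefficients are polynomials in \<open>\<alpha>\<^sub>1\<close>.
\<close>

definition var1 :: "'a::comm_semiring_1 poly poly" where
  "var1 = [:[:0, 1:]:]"

definition var2 :: "'a::comm_semiring_1 poly poly" where
  "var2 = [:0, 1:]"

definition scale2 :: "'a::comm_semiring_0 \<Rightarrow> 'a poly poly \<Rightarrow> 'a poly poly" where
  "scale2 c p = smult [:c:] p"

definition eval2 :: "'a::comm_semiring_0 poly poly \<Rightarrow> 'a \<Rightarrow> 'a \<Rightarrow> 'a" where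
  "eval2 p x y = poly (poly p [:y:]) x"

text \<open>
  \<open>subst2 p q r\<close> is \<open>p(q, r)\<close>. A coefficient \<open>c \<in> F[\<alpha>\<^sub>1]\<close> of \<open>p\<close> becomes \<open>c(q)\<close>: the inner
  \<open>map_poly\<close> reads \<open>c\<close> as a polynomial over \<open>F[\<alpha>\<^sub>1]\<close> with constant coefficients, so that
  \<^const>\<open>pcompose\<close> can substitute \<open>q\<close>.
\<close>

definition subst2 ::
    "'a::comm_semiring_1 poly poly \<Rightarrow> 'a poly poly \<Rightarrow> 'a poly poly \<Rightarrow> 'a poly poly" where
  "subst2 p q r = poly (map_poly (\<lambda>c. pcompose (map_poly (\<lambda>a. [:a:]) c) q) p) r"

definition unit_circle :: "('a::comm_semiring_1 \<times> 'a) set" where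
  "unit_circle = {(x, y). x\<^sup>2 + y\<^sup>2 = 1}"

definition SO2 :: "('a::field^2^2) set" where
  "SO2 = {h. invertible h \<and> matrix_inv h = transpose h \<and> det h = 1}"

definition SO2_act :: "'a::field^2^2 \<Rightarrow> 'a poly poly \<Rightarrow> 'a poly poly" where
  "SO2_act h p =
     subst2 p (scale2 (h$1$1) var1 + scale2 (h$2$1) var2)
              (scale2 (h$1$2) var1 + scale2 (h$2$2) var2)"

definition circular_integral_functional :: "('a::field poly poly \<Rightarrow> 'a) \<Rightarrow> bool" where
  "circular_integral_functional \<phi> \<longleftrightarrow>
     Vector_Spaces.linear scale2 (*) \<phi> \<and>
     \<phi> 1 = 1 \<and>
     (\<forall>p. (\<forall>(x, y) \<in> unit_circle. eval2 p x y = 0) \<longrightarrow> \<phi> p = 0) \<and>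
     (\<forall>p. \<forall>h \<in> SO2. \<phi> (SO2_act h p) = \<phi> p)"

lemma vector_space_scale2: "vector_space (scale2 :: 'a::field \<Rightarrow> _)"
  by unfold_locales (auto simp: scale2_def smult_add_right smult_add_left[symmetric] mult.commute pCons_one)

lemma subst2_pCons:
  "subst2 (pCons c p) q r = pcompose (map_poly (\<lambda>a. [:a:]) c) q + r * subst2 p q r"
  by (simp add: subst2_def map_poly_pCons)

lemma subst2_vars: "subst2 p var1 var2 = p"
proof -
  have "pcompose (map_poly (\<lambda>a. [:a:]) c) var1 = [:c:]" for c :: "'a poly"
    by (induction c) (auto simp: map_poly_pCons pcompose_pCons var1_def)
  then show ?thesis
    by (induction p) (auto simp: subst2_pCons var2_def, simp add: subst2_def)
qed

lemma eval2_subst2: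
  fixes p q r :: "'a::comm_ring_1 poly poly"
  shows "eval2 (subst2 p q r) x y = eval2 p (eval2 q x y) (eval2 r x y)"
proof -
  have "eval2 (pcompose (map_poly (\<lambda>a. [:a:]) c) q) x y = poly c (eval2 q x y)" for c :: "'a poly"
    by (induction c) (auto simp: map_poly_pCons pcompose_pCons eval2_def)
  then show ?thesis
    by (induction p) (auto simp: subst2_pCons, auto simp: subst2_def eval2_def)
qed

lemma eval2_SO2_act:
  "eval2 (SO2_act h p) x y = eval2 p (h$1$1 * x + h$2$1 * y) (h$1$2 * x + h$2$2 * y)"
  unfolding SO2_act_def eval2_subst2 by (simp add: eval2_def scale2_def var1_def var2_def algebra_simps)

end

theory Submission imports Defs begin

text \<open>
  On the circle, every polynomial is a linear combination of the real and imaginary parts of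
  \<open>(x + \<i> y)\<^sup>k\<close>, because multiplying these by \<open>x\<close> or \<open>y\<close> yields half the sum or difference of
  neighbouring ones. The rotation by \<open>w = (3 + 4 \<i>) / 5\<close> multiplies \<open>(x + \<i> y)\<^sup>k\<close> by \<open>w\<^sup>k\<close>, so an
  invariant functional annihilates both parts unless the real part of \<open>w\<^sup>k\<close> is 1. For \<open>k > 0\<close>
  it is not, since the real part of \<open>(3 + 4 \<i>)\<^sup>k\<close> is congruent to 3 modulo 5. Hence the functional
  is determined by its value at the constant polynomial 1.
\<close>

section \<open>Real and imaginary parts of powers\<close>

text \<open>The field need not contain a square root of \<open>-1\<close>, so the two parts are defined by recursion.\<close>

fun re_pow im_pow :: "'a::comm_ring_1 \<Rightarrow> 'a \<Rightarrow> nat \<Rightarrow> 'a" where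
  "re_pow x y 0 = 1"
| "im_pow x y 0 = 0"
| "re_pow x y (Suc k) = x * re_pow x y k - y * im_pow x y k"
| "im_pow x y (Suc k) = y * re_pow x y k + x * im_pow x y k"

text \<open>The arguments on the left are the two parts of (a + i b)(x + i y), and k-th powers are
  multiplicative. Each part refers to the other, so both are proved in one induction.\<close>

lemma re_im_pow_mult:
  "re_pow (a * x - b * y) (b * x + a * y) k = re_pow a b k * re_pow x y k - im_pow a b k * im_pow x y k"
  "im_pow (a * x - b * y) (b * x + a * y) k = im_pow a b k * re_pow x y k + re_pow a b k * im_pow x y k"
proof -
  have "re_pow (a * x - b * y) (b * x + a * y) k = re_pow a b k * re_pow x y k - im_pow a b k * im_pow x y k
    \<and> im_pow (a * x - b * y) (b * x + a * y) k = im_pow a b k * re_pow x y k + re_pow a b k * im_pow x y k"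
    by (induction k) (simp, simp only: re_pow.simps im_pow.simps, simp add: algebra_simps)
  then show "re_pow (a * x - b * y) (b * x + a * y) k = re_pow a b k * re_pow x y k - im_pow a b k * im_pow x y k"
    and "im_pow (a * x - b * y) (b * x + a * y) k = im_pow a b k * re_pow x y k + re_pow a b k * im_pow x y k"
    by auto
qed

lemma re_im_pow_norm: "(re_pow x y k)\<^sup>2 + (im_pow x y k)\<^sup>2 = (x\<^sup>2 + y\<^sup>2) ^ k"
proof (induction k)
  case (Suc k)
  have "(re_pow x y (Suc k))\<^sup>2 + (im_pow x y (Suc k))\<^sup>2
      = (x\<^sup>2 + y\<^sup>2) * ((re_pow x y k)\<^sup>2 + (im_pow x y k)\<^sup>2)"
    by (simp add: power2_eq_square algebra_simps)
  with Suc show ?case by simp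
qed simp

text \<open>For z = x + i y on the circle, 2 x = z + 1/z and 2 i y = z - 1/z; multiply by the
  (k+1)-st power of z and split into parts.\<close>

lemma re_im_pow_recurrence:
  assumes "x\<^sup>2 + y\<^sup>2 = 1"
  shows "2 * (x * re_pow x y (Suc k)) = re_pow x y (Suc (Suc k)) + re_pow x y k"
    and "2 * (x * im_pow x y (Suc k)) = im_pow x y (Suc (Suc k)) + im_pow x y k"
    and "2 * (y * re_pow x y (Suc k)) = im_pow x y (Suc (Suc k)) - im_pow x y k"
    and "2 * (y * im_pow x y (Suc k)) = re_pow x y k - re_pow x y (Suc (Suc k))"
proof -
  have *: "y * (y * r) = r - x * (x * r)" for r
  proof -
    have "r = (x\<^sup>2 + y\<^sup>2) * r" using assms by simp
    then show ?thesis by (simp add: power2_eq_square algebra_simps)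
  qed
  show "2 * (x * re_pow x y (Suc k)) = re_pow x y (Suc (Suc k)) + re_pow x y k"
    and "2 * (x * im_pow x y (Suc k)) = im_pow x y (Suc (Suc k)) + im_pow x y k"
    and "2 * (y * re_pow x y (Suc k)) = im_pow x y (Suc (Suc k)) - im_pow x y k"
    and "2 * (y * im_pow x y (Suc k)) = re_pow x y k - re_pow x y (Suc (Suc k))"
    by (simp_all add: algebra_simps *)
qed

text \<open>Modulo 5 the number 3 + 4 i is idempotent: its square is -7 + 24 i. Hence all its
  positive powers are congruent to it.\<close>

lemma re_im_pow_3_4_mod_5:
  "re_pow (3::int) 4 (Suc k) mod 5 = 3 \<and> im_pow (3::int) 4 (Suc k) mod 5 = 4"
proof (induction k)
  case (Suc k)
  then obtain a b :: int where "re_pow 3 4 (Suc k) = 3 + 5 * a" "im_pow 3 4 (Suc k) = 4 + 5 * b"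
    by (metis mod_mult_div_eq)
  then have "re_pow 3 4 (Suc (Suc k)) = 3 + 5 * (3 * a - 4 * b - 2)"
    and "im_pow 3 4 (Suc (Suc k)) = 4 + 5 * (4 * a + 3 * b + 4)"
    unfolding re_pow.simps(2)[of _ _ "Suc k"] im_pow.simps(2)[of _ _ "Suc k"] by simp_all
  then show ?case by (simp only: mod_mult_self2) simp
qed simp

text \<open>Clearing denominators moves the question from the field to the integers, where
  congruences modulo 5 make sense.\<close>

lemma re_im_pow_3_4_div_5:
  "5 ^ k * re_pow (3 / 5) (4 / 5) k = (of_int (re_pow 3 4 k) :: 'a::field_char_0)"
  "5 ^ k * im_pow (3 / 5) (4 / 5) k = (of_int (im_pow 3 4 k) :: 'a::field_char_0)"
proof -
  have "5 ^ k * re_pow (3 / 5) (4 / 5) k = (of_int (re_pow 3 4 k) :: 'a)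
    \<and> 5 ^ k * im_pow (3 / 5) (4 / 5) k = (of_int (im_pow 3 4 k) :: 'a)"
  proof (induction k)
    case (Suc k)
    have "5 ^ Suc k * re_pow (3 / 5) (4 / 5) (Suc k)
        = 3 * (5 ^ k * re_pow (3 / 5) (4 / 5) k) - 4 * (5 ^ k * im_pow (3 / 5) (4 / 5) k :: 'a)"
      by (simp add: right_diff_distrib)
    moreover have "5 ^ Suc k * im_pow (3 / 5) (4 / 5) (Suc k)
        = 4 * (5 ^ k * re_pow (3 / 5) (4 / 5) k) + 3 * (5 ^ k * im_pow (3 / 5) (4 / 5) k :: 'a)"
      by (simp add: distrib_left)
    ultimately show ?case using Suc by simp
  qed simp
  then show "5 ^ k * re_pow (3 / 5) (4 / 5) k = (of_int (re_pow 3 4 k) :: 'a)"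
    and "5 ^ k * im_pow (3 / 5) (4 / 5) k = (of_int (im_pow 3 4 k) :: 'a)"
    by auto
qed

lemma re_pow_3_4_div_5_neq_1: "re_pow (3 / 5) (4 / 5) (Suc k) \<noteq> (1::'a::field_char_0)"
proof
  assume "re_pow (3 / 5) (4 / 5) (Suc k) = (1::'a)"
  then have "(of_int (5 ^ Suc k) :: 'a) = of_int (re_pow 3 4 (Suc k))"
    using re_im_pow_3_4_div_5(1)[of "Suc k", where 'a = 'a] by (simp del: re_pow.simps)
  \<comment> \<open>Characteristic zero makes \<open>of_int\<close> injective.\<close>
  then have "re_pow 3 4 (Suc k) = (5::int) ^ Suc k"
    by (simp only: of_int_eq_iff)
  then have "re_pow (3::int) 4 (Suc k) mod 5 = 0" by (simp del: re_pow.simps)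
  then show False using re_im_pow_3_4_mod_5[of k] by (simp del: re_pow.simps)
qed

section \<open>Evaluation, monomials and rotations\<close>

lemma eval2_simps [simp]:
  fixes p q :: "'a::comm_ring_1 poly poly"
  shows "eval2 0 x y = 0" "eval2 1 x y = 1"
    "eval2 (p + q) x y = eval2 p x y + eval2 q x y"
    "eval2 (p - q) x y = eval2 p x y - eval2 q x y"
    "eval2 (p * q) x y = eval2 p x y * eval2 q x y"
    "eval2 (scale2 c p) x y = c * eval2 p x y"
    "eval2 var1 x y = x" "eval2 var2 x y = y"
  by (simp_all add: eval2_def scale2_def var1_def var2_def)

lemma eval2_re_im_pow [simp]:
  fixes p q :: "'a::comm_ring_1 poly poly"
  shows "eval2 (re_pow p q k) x y = re_pow (eval2 p x y) (eval2 q x y) k"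
    "eval2 (im_pow p q k) x y = im_pow (eval2 p x y) (eval2 q x y) k"
  by (induction k) simp_all

text \<open>Horner's scheme in each variable builds every polynomial from 1 by these
  operations.\<close>

lemma poly_poly_induct [case_names one add scale var1 var2]:
  fixes p :: "'a::comm_ring_1 poly poly"
  assumes one: "P 1"
    and add: "\<And>p q. P p \<Longrightarrow> P q \<Longrightarrow> P (p + q)"
    and scale: "\<And>c p. P p \<Longrightarrow> P (scale2 c p)"
    and var1: "\<And>p. P p \<Longrightarrow> P (var1 * p)"
    and var2: "\<And>p. P p \<Longrightarrow> P (var2 * p)"
  shows "P p"
proof -
  have zero: "P 0" using scale[OF one, of 0] by (simp add: scale2_def)
  have const: "P [:c:]" for c
  proof (induction c)
    case (pCons a c)
    have "[:pCons a c:] = scale2 a 1 + var1 * [:c:]"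
      by (simp add: scale2_def var1_def)
    then show ?case using add scale one var1 pCons by metis
  qed (use zero in simp)
  show ?thesis
  proof (induction p)
    case (pCons c p)
    have "pCons c p = [:c:] + var2 * p" by (simp add: var2_def)
    then show ?case using add const var2 pCons by metis
  qed (rule zero)
qed

text \<open>\<open>SO2_act\<close> takes its coefficients from the columns of the matrix, so this
  transpose of the usual rotation matrix acts on points as multiplication by a + i b.\<close>

definition rotation :: "'a::field \<Rightarrow> 'a \<Rightarrow> 'a^2^2" where
  "rotation a b = vector [vector [a, b], vector [- b, a]]"

lemma rotation_in_SO2:
  assumes "a\<^sup>2 + b\<^sup>2 = 1"
  shows "rotation a b \<in> SO2"
proof -
  let ?h = "rotation a b"
  have inv: "?h ** transpose ?h = mat 1" "transpose ?h ** ?h = mat 1"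
    using assms
    by (simp_all add: rotation_def vec_eq_iff forall_2 matrix_matrix_mult_def transpose_def sum_2
        mat_def power2_eq_square add.commute)
  then have "invertible ?h" by (auto simp: invertible_def)
  moreover have "matrix_inv ?h = transpose ?h"
  proof -
    have h: "?h ** matrix_inv ?h = mat 1"
      unfolding matrix_inv_def by (rule someI2[of _ "transpose ?h"]) (use inv in auto)
    have "transpose ?h ** (?h ** matrix_inv ?h) = matrix_inv ?h"
      by (simp add: matrix_mul_assoc inv)
    then show ?thesis by (simp add: h)
  qed
  moreover have "det ?h = 1"
    using assms by (simp add: rotation_def det_2 power2_eq_square)
  ultimately show ?thesis by (simp add: SO2_def)
qed

lemma eval2_rotation:
  "eval2 (SO2_act (rotation a b) p) x y = eval2 p (a * x - b * y) (b * x + a * y)"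
  by (simp add: eval2_SO2_act rotation_def)

section \<open>Rotation invariant functionals on the circle\<close>

text \<open>Designed for the difference of two circular integral functionals, which inherits these
  properties but sends 1 to 0.\<close>

locale invariant_functional =
  fixes \<psi> :: "'a::field_char_0 poly poly \<Rightarrow> 'a"
  assumes add: "\<psi> (p + q) = \<psi> p + \<psi> q"
    and scale: "\<psi> (scale2 c p) = c * \<psi> p"
    and locality: "(\<And>x y. x\<^sup>2 + y\<^sup>2 = 1 \<Longrightarrow> eval2 p x y = 0) \<Longrightarrow> \<psi> p = 0"
    and invariant: "h \<in> SO2 \<Longrightarrow> \<psi> (SO2_act h p) = \<psi> p"
begin

lemma diff: "\<psi> (p - q) = \<psi> p - \<psi> q"
  using add[of "p - q" q] by simp

lemma cong:
  assumes "\<And>x y. x\<^sup>2 + y\<^sup>2 = 1 \<Longrightarrow> eval2 p x y = eval2 q x y"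
  shows "\<psi> p = \<psi> q"
  using locality[of "p - q"] assms by (simp add: diff)

lemma rotation_cong:
  assumes "a\<^sup>2 + b\<^sup>2 = 1"
    and "\<And>x y. x\<^sup>2 + y\<^sup>2 = 1 \<Longrightarrow> eval2 p (a * x - b * y) (b * x + a * y) = eval2 q x y"
  shows "\<psi> p = \<psi> q"
proof -
  have "\<psi> (SO2_act (rotation a b) p) = \<psi> q"
    by (rule cong) (simp add: eval2_rotation assms(2))
  then show ?thesis by (simp add: invariant rotation_in_SO2 assms(1))
qed

lemma re_im_pow_Suc_eq_0:
  "\<psi> (re_pow var1 var2 (Suc k)) = 0" "\<psi> (im_pow var1 var2 (Suc k)) = 0"
proof -
  define c s where "c = re_pow (var1 :: 'a poly poly) var2 (Suc k)"
    and "s = im_pow (var1 :: 'a poly poly) var2 (Suc k)"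
  define A B where "A = re_pow (3 / 5 :: 'a) (4 / 5) (Suc k)"
    and "B = im_pow (3 / 5 :: 'a) (4 / 5) (Suc k)"
  have unit: "(3 / 5 :: 'a)\<^sup>2 + (4 / 5)\<^sup>2 = 1"
    by (simp add: power2_eq_square)
  have AB: "A\<^sup>2 + B\<^sup>2 = 1"
    unfolding A_def B_def re_im_pow_norm unit by simp
  have "A \<noteq> 1" unfolding A_def by (rule re_pow_3_4_div_5_neq_1)
  have "\<psi> c = \<psi> (scale2 A c - scale2 B s)"
    unfolding c_def s_def A_def B_def
    by (rule rotation_cong[OF unit]) (simp only: eval2_simps eval2_re_im_pow re_im_pow_mult)
  then have c: "\<psi> c = A * \<psi> c - B * \<psi> s" by (simp add: diff scale)
  have "\<psi> s = \<psi> (scale2 B c + scale2 A s)"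
    unfolding c_def s_def A_def B_def
    by (rule rotation_cong[OF unit]) (simp only: eval2_simps eval2_re_im_pow re_im_pow_mult)
  then have s: "\<psi> s = B * \<psi> c + A * \<psi> s" by (simp add: add scale)
  \<comment> \<open>By \<open>c\<close> and \<open>s\<close>, the matrix of multiplication by A + i
    B fixes the vector (\<psi> c, \<psi> s). Subtracting the identity leaves determinant (A - 1)^2 +
    B^2 = 2 - 2 A, which is nonzero.\<close>
  have "(2 - 2 * A) * \<psi> c = 0"
    using c s AB by algebra
  moreover have "(2 - 2 * A) * \<psi> s = 0"
    using c s AB by algebra
  ultimately show "\<psi> (re_pow var1 var2 (Suc k)) = 0" "\<psi> (im_pow var1 var2 (Suc k)) = 0"
    using \<open>A \<noteq> 1\<close> unfolding c_def[symmetric] s_def[symmetric] by simp_all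
qed

text \<open>The induction step for \<open>eq_0\<close>: the recurrences trade a factor
  \<open>var1\<close> or \<open>var2\<close> for a shift of k, which the assumptions allow because
  they cover all k.\<close>

lemma mult_var_eq_0:
  assumes "\<And>k. \<psi> (p * re_pow var1 var2 k) = 0" "\<And>k. \<psi> (p * im_pow var1 var2 k) = 0"
  shows "\<psi> (var1 * p * re_pow var1 var2 k) = 0" "\<psi> (var1 * p * im_pow var1 var2 k) = 0"
    and "\<psi> (var2 * p * re_pow var1 var2 k) = 0" "\<psi> (var2 * p * im_pow var1 var2 k) = 0"
proof -
  let ?c = "re_pow (var1 :: 'a poly poly) var2" and ?s = "im_pow (var1 :: 'a poly poly) var2"
  have half: "\<psi> q = 0"
    if "\<psi> r = 0"
      and "\<And>x y. x\<^sup>2 + y\<^sup>2 = 1 \<Longrightarrow> 2 * eval2 q x y = eval2 r x y" for q r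
  proof -
    have "\<psi> (scale2 2 q) = \<psi> r" by (rule cong) (simp add: that(2))
    then show ?thesis using that(1) by (simp add: scale)
  qed
  have "\<psi> (var1 * p * ?c k) = 0 \<and> \<psi> (var1 * p * ?s k) = 0 \<and>
        \<psi> (var2 * p * ?c k) = 0 \<and> \<psi> (var2 * p * ?s k) = 0"
  proof (cases k)
    \<comment> \<open>The recurrences start at exponent 1. At exponent 0 the parts are 1 and 0, and
      the variables themselves are the parts at exponent 1.\<close>
    case 0
    have "\<psi> 0 = 0" using scale[of 0 0] by (simp add: scale2_def)
    then show ?thesis
      using assms(1)[of 1] assms(2)[of 1] 0 by (simp add: mult.commute)
  next
    case (Suc j)
    have eq: "2 * (v * e * t) = e * (2 * (v * t))" for v e t :: 'a by simp
    have "\<psi> (var1 * p * ?c (Suc j)) = 0"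
      by (rule half[of "p * ?c (Suc (Suc j)) + p * ?c j"])
        (simp only: add assms add_0,
         simp only: eval2_simps eval2_re_im_pow eq re_im_pow_recurrence distrib_left)
    moreover have "\<psi> (var1 * p * ?s (Suc j)) = 0"
      by (rule half[of "p * ?s (Suc (Suc j)) + p * ?s j"])
        (simp only: add assms add_0,
         simp only: eval2_simps eval2_re_im_pow eq re_im_pow_recurrence distrib_left)
    moreover have "\<psi> (var2 * p * ?c (Suc j)) = 0"
      by (rule half[of "p * ?s (Suc (Suc j)) - p * ?s j"])
        (simp only: diff assms diff_self,
         simp only: eval2_simps eval2_re_im_pow eq re_im_pow_recurrence right_diff_distrib)
    moreover have "\<psi> (var2 * p * ?s (Suc j)) = 0"
      by (rule half[of "p * ?c j - p * ?c (Suc (Suc j))"])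
        (simp only: diff assms diff_self,
         simp only: eval2_simps eval2_re_im_pow eq re_im_pow_recurrence right_diff_distrib)
    ultimately show ?thesis unfolding Suc by blast
  qed
  then show "\<psi> (var1 * p * ?c k) = 0" "\<psi> (var1 * p * ?s k) = 0"
    "\<psi> (var2 * p * ?c k) = 0" "\<psi> (var2 * p * ?s k) = 0" by auto
qed

lemma eq_0:
  assumes "\<psi> 1 = 0"
  shows "\<psi> p = 0"
proof -
  \<comment> \<open>Strengthened so that multiplication by a variable preserves it; k = 0 in the
    first conjunct recovers the claim.\<close>
  have "\<forall>k. \<psi> (p * re_pow var1 var2 k) = 0 \<and> \<psi> (p * im_pow var1 var2 k) = 0"
  proof (induction p rule: poly_poly_induct)
    case one
    have "\<psi> 0 = 0" using scale[of 0 0] by (simp add: scale2_def)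
    show ?case
    proof
      fix k
      show "\<psi> (1 * re_pow var1 var2 k) = 0 \<and> \<psi> (1 * im_pow var1 var2 k) = 0"
        using assms \<open>\<psi> 0 = 0\<close> re_im_pow_Suc_eq_0
        by (cases k) (simp_all only: mult_1 re_pow.simps(1) im_pow.simps(1))
    qed
  next
    case (scale c p)
    have "scale2 c p * q = scale2 c (p * q)" for q by (simp add: scale2_def)
    with scale show ?case by (simp add: invariant_functional.scale[OF invariant_functional_axioms])
  qed (simp_all add: distrib_right add mult_var_eq_0)
  from this[THEN spec, of 0] show ?thesis by simp
qed

end

theorem theorem13:
  fixes \<phi> \<phi>' :: "'a::field_char_0 poly poly \<Rightarrow> 'a"
  assumes "circular_integral_functional \<phi>"
    and "circular_integral_functional \<phi>'"
  shows "\<phi> = \<phi>'"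
proof
  fix p
  note defs = assms[unfolded circular_integral_functional_def]
  from defs interpret \<phi>: Vector_Spaces.linear scale2 "(*)" \<phi> by blast
  from defs interpret \<phi>': Vector_Spaces.linear scale2 "(*)" \<phi>' by blast
  interpret invariant_functional "\<lambda>p. \<phi> p - \<phi>' p"
  proof
    fix p :: "'a poly poly"
    assume "\<And>x y. x\<^sup>2 + y\<^sup>2 = 1 \<Longrightarrow> eval2 p x y = 0"
    then have "\<forall>(x, y) \<in> unit_circle. eval2 p x y = 0" by (auto simp: unit_circle_def)
    then show "\<phi> p - \<phi>' p = 0" using defs by simp
  qed (use defs in \<open>simp_all add: \<phi>.add \<phi>'.add \<phi>.scale \<phi>'.scale algebra_simps\<close>)
  have "\<phi> 1 - \<phi>' 1 = 0" using defs by simp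
  from eq_0[OF this] show "\<phi> p = \<phi>' p" by simp
qed

end
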